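(* Let $\alpha,\beta,\gamma,A,B,C$ be positive real numbers, and let $$p=\frac{AB+(B+C)\beta}{AC+(B+C)\gamma},\quad q=\frac{B}{C},\quad r=\frac{C(B+C)(B\alpha+C\alpha-A\beta-A\gamma)}{(\gamma(B+C)+AC)^2},\quad L=\frac{AC}{AC+(B+C)\gamma}.$$ Then every solution $\{y_n\}_{n\ge -1}$ of $$y_{n+1}=\frac{r+p\,y_n+y_{n-1}}{q\,y_n+y_{n-1}},\quad n=0,1,2,\dots,\qquad y_{-1},y_0\in[L,\infty),$$ converges to the unique equilibrium or to a prime period-two solution.
   Context: A solution is a sequence $\{y_n\}_{n\ge -1}$ with initial values in $[L,\infty)$ satisfying the recursion (all its terms then lie in $[L,\infty)$). An equilibrium is a number $\overline{y}\in[L,\infty)$ such that the constant sequence $y_n=\overline{y}$ is a solution; the unique equilibrium is $\overline{y}=\frac{p+1+\sqrt{(p+1)^2+4r(q+1)}}{2(q+1)}$. Note that $r$ may be negative. A prime period-two solution is a solution $\{p_n\}_{n\ge -1}$ with $p_{n+2}=p_n$ for all $n\ge -1$ and $p_{-1}\neq p_0$. A solution $\{y_n\}$ converges to a prime period-two solution $\{p_n\}$ if $y_n-p_n\to 0$ as $n\to\infty$. *)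

theory Defs
  imports "HOL-Analysis.Analysis"
begin

text \<open>
  Sequences $(y_n)_{n \ge -1}$ are functions on the natural numbers shifted by one:
  \<open>y 0\<close> stands for $y_{-1}$, \<open>y 1\<close> for $y_0$, and \<open>y (n + 2)\<close> for $y_{n+1}$.
\<close>

definition is_solution :: "real \<Rightarrow> real \<Rightarrow> real \<Rightarrow> real \<Rightarrow> (nat \<Rightarrow> real) \<Rightarrow> bool" where
  "is_solution p q r L y \<longleftrightarrow>
     y 0 \<in> {L..} \<and> y 1 \<in> {L..} \<and>
     (\<forall>n. y (n + 2) = (r + p * y (n + 1) + y n) / (q * y (n + 1) + y n))"

definition is_equilibrium :: "real \<Rightarrow> real \<Rightarrow> real \<Rightarrow> real \<Rightarrow> real \<Rightarrow> bool" where
  "is_equilibrium p q r L e \<longleftrightarrow> e \<in> {L..} \<and> is_solution p q r L (\<lambda>n. e)"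

definition ybar :: "real \<Rightarrow> real \<Rightarrow> real \<Rightarrow> real" where
  "ybar p q r = (p + 1 + sqrt ((p + 1)\<^sup>2 + 4 * r * (q + 1))) / (2 * (q + 1))"

definition is_prime_period_two :: "real \<Rightarrow> real \<Rightarrow> real \<Rightarrow> real \<Rightarrow> (nat \<Rightarrow> real) \<Rightarrow> bool" where
  "is_prime_period_two p q r L u \<longleftrightarrow>
     is_solution p q r L u \<and> (\<forall>n. u (n + 2) = u n) \<and> u 0 \<noteq> u 1"

end

theory Submission
  imports Defs
begin

text \<open>
  Write $f(u,v) = (r + pu + v)/(qu + v)$, so that $y_{n+1} = f(y_n, y_{n-1})$, let $e$ be the
  equilibrium, and let $m$ and $M$ be the lower and upper limit of a solution, which is bounded. The
  parameters enter only through $p, q > 0$, $0 < L < 1$, $qL < p$ and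
  $\varphi(L) > 0$, where $\varphi(x) = r + (p+1)x - (q+1)x^2$ has the sign of $e - x$ on
  $[L,\infty)$. By compactness $m = f(u,v)$ and $M = f(u',v')$ for some points of $[m,M]$, and since
  $f$ is linear fractional in each argument, such an equation can be compared with the corners of the
  square $[m,M]^2$. The decisive consequence is \<open>concentrated_if_M_le_diagonal\<close>: if $M \le f(m,m)$ then
  $m = M = e$. This premise is met whenever $M \ge \max(1, p/q)$.

  The recursion can be centred at the equilibrium,
  $(y_{n+1} - e)(q y_n + y_{n-1}) = (p - qe)(y_n - e) + (1 - e)(y_{n-1} - e)$,
  and the signs of the two coefficients separate four cases.

  \<^item> If both are nonnegative or both are nonpositive, these one-step estimates give
    $m = M = e$.

  \<^item> If $p/q < e < 1$, then a solution that does not converge to $e$ eventually lies in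
    $(p/q, 1)$. There $f$ decreases in its first and increases in its second argument, so the terms of
    even and of odd index are eventually monotone. Their two limits form a solution of period two,
    or coincide and equal $e$.

  \<^item> If $1 < e < p/q$, solutions may spiral around $e$, and comparing extremes is not enough. Here a
    Lyapunov function helps. For fixed $u$ the map $v \mapsto f(u,v)$ has the same fixed points as the
    involution $v \mapsto v'$ given by $v v' + \frac{qu-1}{2}(v + v') = r + pu$. The planar map
    $(u,v) \mapsto (v',u)$ is integrable: it preserves a ratio of symmetric biquadratic
    polynomials. Among its invariants is $N(u,v)/(s(u)s(v))$ with
    $s(x) = 2px - qx^2 - p - qr$. In the coordinate that sends the two fixed points to $0$ and $\infty$,
    the involution is multiplication by $-1$ and $f(u,\cdot)$ is multiplication by a number of
    absolute value less than $1$. Along a solution the invariant accordingly drops by a multiple of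
    $(y_{n+1} - y_{n-1})^2$ (\<open>lyapunov_identity\<close>). A solution that did not converge to $e$
    would eventually stay where $s$ is positive and the drop is strict, so
    $y_{n+1} - y_{n-1} \to 0$. Then $M = f(u,M)$ and $m = f(u',m)$, and as $f$ increases in its
    first argument there, $M \le f(M,M)$ and $m \ge f(m,m)$, that is $e \le m \le M \le e$.
\<close>

section \<open>Upper and lower limits of a bounded sequence\<close>

text \<open>
  The limits inferior and superior as real numbers, characterised by the two properties that the
  estimates need: they are attained along subsequences, and they bound the sequence eventually up to
  any margin.
\<close>

definition asymptotic_range :: "(nat \<Rightarrow> real) \<Rightarrow> real \<Rightarrow> real \<Rightarrow> bool" where
  "asymptotic_range y m M \<longleftrightarrow>
     (\<exists>\<rho>. strict_mono \<rho> \<and> (\<lambda>n. y (\<rho> n)) \<longlonglongrightarrow> m) \<and>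
     (\<exists>\<rho>. strict_mono \<rho> \<and> (\<lambda>n. y (\<rho> n)) \<longlonglongrightarrow> M) \<and>
     (\<forall>c<m. \<forall>\<^sub>F n in sequentially. c < y n) \<and>
     (\<forall>c>M. \<forall>\<^sub>F n in sequentially. y n < c)"

lemma bounded_largest_limit_point:
  fixes y :: "nat \<Rightarrow> real"
  assumes "\<And>n. \<bar>y n\<bar> \<le> K"
  shows "\<exists>M. (\<exists>\<rho>. strict_mono \<rho> \<and> (\<lambda>n. y (\<rho> n)) \<longlonglongrightarrow> M) \<and>
             (\<forall>c>M. \<forall>\<^sub>F n in sequentially. y n < c)"
proof -
  let ?l = "limsup (\<lambda>n. ereal (y n))"
  have "?l \<le> ereal K"
    by (rule Limsup_bounded) (use assms in \<open>simp add: abs_le_iff\<close>)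
  moreover have "ereal (- K) \<le> ?l"
    by (rule le_Limsup) (use assms in \<open>auto intro!: always_eventually simp: abs_le_iff minus_le_iff\<close>)
  ultimately obtain M where M: "?l = ereal M"
    by (cases ?l) auto
  obtain \<rho> where "strict_mono \<rho>" "((\<lambda>n. ereal (y n)) \<circ> \<rho>) \<longlonglongrightarrow> ?l"
    using limsup_subseq_lim by blast
  moreover have "\<forall>\<^sub>F n in sequentially. y n < c" if "M < c" for c
    using Limsup_lessD[of sequentially "\<lambda>n. ereal (y n)" "ereal c"] that M by simp
  ultimately show ?thesis
    unfolding M by (auto simp: o_def)
qed

lemma bounded_has_asymptotic_range:
  fixes y :: "nat \<Rightarrow> real"
  assumes "\<And>n. \<bar>y n\<bar> \<le> K"
  shows "\<exists>m M. asymptotic_range y m M"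
proof -
  obtain M where M: "\<exists>\<rho>. strict_mono \<rho> \<and> (\<lambda>n. y (\<rho> n)) \<longlonglongrightarrow> M"
      "\<forall>c>M. \<forall>\<^sub>F n in sequentially. y n < c"
    using bounded_largest_limit_point[of y K] assms by blast
  obtain m \<rho> where m: "strict_mono \<rho>" "(\<lambda>n. - y (\<rho> n)) \<longlonglongrightarrow> m"
      "\<forall>c>m. \<forall>\<^sub>F n in sequentially. - y n < c"
    using bounded_largest_limit_point[of "\<lambda>n. - y n" K] assms by auto
  have "(\<lambda>n. y (\<rho> n)) \<longlonglongrightarrow> - m"
    using tendsto_minus[OF m(2)] by simp
  moreover have "\<forall>\<^sub>F n in sequentially. c < y n" if "c < - m" for c
    using m(3)[rule_format, of "- c"] that by simp
  ultimately show ?thesis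
    using M m(1) unfolding asymptotic_range_def by blast
qed

lemma asymptotic_range_bounds_limits:
  assumes "asymptotic_range y m M" and "filterlim \<rho> at_top sequentially"
    and "(\<lambda>n. y (\<rho> n)) \<longlonglongrightarrow> x"
  shows "m \<le> x" "x \<le> M"
proof -
  show "x \<le> M"
  proof (rule dense_ge)
    fix c assume "M < c"
    then have "\<forall>\<^sub>F n in sequentially. y n < c"
      using assms(1) by (simp add: asymptotic_range_def)
    from filterlim_iff[THEN iffD1, OF assms(2), rule_format, OF this]
    have "\<forall>\<^sub>F n in sequentially. y (\<rho> n) \<le> c"
      by (rule eventually_mono) simp
    then show "x \<le> c"
      using tendsto_upperbound[OF assms(3)] by simp
  qed
  show "m \<le> x"
  proof (rule dense_le)
    fix c assume "c < m"
    then have "\<forall>\<^sub>F n in sequentially. c < y n"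
      using assms(1) by (simp add: asymptotic_range_def)
    from filterlim_iff[THEN iffD1, OF assms(2), rule_format, OF this]
    have "\<forall>\<^sub>F n in sequentially. c \<le> y (\<rho> n)"
      by (rule eventually_mono) simp
    then show "c \<le> x"
      using tendsto_lowerbound[OF assms(3)] by simp
  qed
qed

text \<open>
  For a sequence that solves a second-order recursion this makes every limit point the image of
  two limit points, and so replaces $\varepsilon$-estimates by exact equations between
  limit points.
\<close>

lemma limit_point_predecessors:
  fixes y :: "nat \<Rightarrow> real"
  assumes bd: "\<And>n. \<bar>y n\<bar> \<le> K" and \<rho>: "strict_mono \<rho>" "(\<lambda>n. y (\<rho> n)) \<longlonglongrightarrow> c"
  obtains \<sigma> u v where "filterlim \<sigma> at_top sequentially" "(\<lambda>n. y (\<sigma> n)) \<longlonglongrightarrow> v"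
    "(\<lambda>n. y (Suc (\<sigma> n))) \<longlonglongrightarrow> u" "(\<lambda>n. y (Suc (Suc (\<sigma> n)))) \<longlonglongrightarrow> c"
proof -
  define \<tau> where "\<tau> n = \<rho> (n + 2) - 2" for n
  have ge: "n + 2 \<le> \<rho> (n + 2)" for n
    using \<rho>(1) by (rule strict_mono_imp_increasing)
  have \<tau>: "Suc (Suc (\<tau> n)) = \<rho> (n + 2)" for n
    using ge[of n] by (simp add: \<tau>_def)
  have \<tau>mono: "strict_mono \<tau>"
  proof (rule strict_monoI)
    fix a b :: nat assume "a < b"
    then have "\<rho> (a + 2) < \<rho> (b + 2)"
      using \<rho>(1) by (simp add: strict_mono_less)
    then show "\<tau> a < \<tau> b"
      using \<tau>[of a] \<tau>[of b] by linarith
  qed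
  have "bounded (range (\<lambda>n. (y (\<tau> n), y (Suc (\<tau> n)))))"
  proof (rule bounded_subset)
    show "bounded (cball 0 K \<times> cball (0::real) K)"
      by (intro bounded_Times bounded_cball)
  qed (use bd in auto)
  then obtain l \<kappa> where \<kappa>: "strict_mono \<kappa>"
      "((\<lambda>n. (y (\<tau> n), y (Suc (\<tau> n)))) \<circ> \<kappa>) \<longlonglongrightarrow> l"
    using bounded_imp_convergent_subsequence by blast
  have "(\<lambda>n. y (\<tau> (\<kappa> n))) \<longlonglongrightarrow> fst l" "(\<lambda>n. y (Suc (\<tau> (\<kappa> n)))) \<longlonglongrightarrow> snd l"
    using tendsto_fst[OF \<kappa>(2)] tendsto_snd[OF \<kappa>(2)] by (simp_all add: o_def)
  moreover have "(\<lambda>n. y (Suc (Suc (\<tau> (\<kappa> n))))) \<longlonglongrightarrow> c"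
    using LIMSEQ_subseq_LIMSEQ[OF LIMSEQ_ignore_initial_segment[OF \<rho>(2), of 2] \<kappa>(1)]
    by (simp add: \<tau> o_def)
  moreover have "filterlim (\<lambda>n. \<tau> (\<kappa> n)) at_top sequentially"
    using filterlim_subseq[OF strict_mono_o[OF \<tau>mono \<kappa>(1)]] by (simp add: o_def)
  ultimately show thesis
    using that by blast
qed

section \<open>Convergence of auxiliary sequences\<close>

text \<open>
  If $y_{n+2} - y_n$ and $y_{n+3} - y_{n+1}$ ever have opposite weak signs, monotonicity makes the
  signs alternate from then on. Otherwise all these differences have the same strict sign. Either
  way both interlaced subsequences are eventually monotone.
\<close>

lemma antitone_isotone_recursion_converges:
  fixes y :: "nat \<Rightarrow> real" and f :: "real \<Rightarrow> real \<Rightarrow> real"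
  assumes rec: "\<And>n. y (n + 2) = f (y (n + 1)) (y n)" and bd: "\<And>n. \<bar>y n\<bar> \<le> K"
    and mono: "\<And>i j k l. y j \<le> y i \<Longrightarrow> y k \<le> y l \<Longrightarrow> f (y i) (y k) \<le> f (y j) (y l)"
  obtains a b where "(\<lambda>n. y (2 * n)) \<longlonglongrightarrow> a" "(\<lambda>n. y (2 * n + 1)) \<longlonglongrightarrow> b"
proof -
  define rises where "rises n \<longleftrightarrow> y n \<le> y (n + 2)" for n
  define falls where "falls n \<longleftrightarrow> y (n + 2) \<le> y n" for n
  have tot: "rises n \<or> falls n" for n
    unfolding rises_def falls_def by linarith
  have s1: "falls (n + 2)" if "falls n" "rises (n + 1)" for n
    using mono[of "n + 1" "n + 3" "n + 2" n] that rec[of n] rec[of "n + 2"]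
    by (simp add: falls_def rises_def eval_nat_numeral)
  have s2: "rises (n + 2)" if "rises n" "falls (n + 1)" for n
    using mono[of "n + 3" "n + 1" n "n + 2"] that rec[of n] rec[of "n + 2"]
    by (simp add: falls_def rises_def eval_nat_numeral)
  have alt: "(rises (k + 2 * n) \<and> falls (k + 2 * n + 1))" if "rises k" "falls (k + 1)" for k n
  proof (induction n)
    case (Suc n)
    then have "rises (k + 2 * n + 2)" using s2[of "k + 2 * n"] by simp
    then have "falls (k + 2 * n + 1 + 2)" using Suc s1[of "k + 2 * n + 1"] by simp
    with \<open>rises (k + 2 * n + 2)\<close> show ?case by (simp add: ac_simps)
  qed (use that in simp)
  have alt': "(falls (k + 2 * n) \<and> rises (k + 2 * n + 1))" if "falls k" "rises (k + 1)" for k n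
  proof (induction n)
    case (Suc n)
    then have "falls (k + 2 * n + 2)" using s1[of "k + 2 * n"] by simp
    then have "rises (k + 2 * n + 1 + 2)" using Suc s2[of "k + 2 * n + 1"] by simp
    with \<open>falls (k + 2 * n + 2)\<close> show ?case by (simp add: ac_simps)
  qed (use that in simp)
  have "\<exists>k0. \<forall>i<2. (\<forall>n. rises (k0 + i + 2 * n)) \<or> (\<forall>n. falls (k0 + i + 2 * n))"
  proof (cases "\<exists>k. rises k \<and> falls (k + 1) \<or> falls k \<and> rises (k + 1)")
    case True
    then obtain k where k: "rises k \<and> falls (k + 1) \<or> falls k \<and> rises (k + 1)" by blast
    show ?thesis
    proof (intro exI[of _ k] allI impI)
      fix i :: nat assume "i < 2"
      then consider "i = 0" | "i = 1" by linarith
      then show "(\<forall>n. rises (k + i + 2 * n)) \<or> (\<forall>n. falls (k + i + 2 * n))"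
        using k alt alt' by cases (simp, blast, simp, blast)
    qed
  next
    case False
    have same: "rises n = rises 0 \<and> falls n = falls 0" for n
    proof (induction n)
      case (Suc n)
      then show ?case using False tot[of n] tot[of "n + 1"] by auto
    qed simp
    show ?thesis using tot[of 0] same by blast
  qed
  then obtain k0 where k0: "\<And>i. i < 2 \<Longrightarrow> (\<forall>n. rises (k0 + i + 2 * n)) \<or> (\<forall>n. falls (k0 + i + 2 * n))"
    by blast
  have conv: "convergent (\<lambda>n. y (k0 + i + 2 * n))" if "i < 2" for i
  proof -
    have "monoseq (\<lambda>n. y (k0 + i + 2 * n))"
      using k0[OF that] unfolding monoseq_Suc rises_def falls_def by (simp add: ac_simps)
    moreover have "Bseq (\<lambda>n. y (k0 + i + 2 * n))"
      using bd by (intro BseqI'[of _ K]) simp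
    ultimately show ?thesis by (rule Bseq_monoseq_convergent[rotated])
  qed
  \<comment> \<open>Renumbering: if \<open>k0\<close> is odd, the two parity classes of the tail are swapped.\<close>
  have ev: "convergent (\<lambda>n. y (2 * n + j))" if "j < 2" for j
  proof -
    define i where "i = (k0 + j) mod 2"
    define d where "d = (k0 + i) div 2"
    have i2: "i < 2" by (simp add: i_def)
    have "(k0 + i) mod 2 = j" using that unfolding i_def by presburger
    then have eq: "k0 + i + 2 * n = 2 * (n + d) + j" for n
      unfolding d_def using div_mult_mod_eq[of "k0 + i" 2] by simp
    show ?thesis
      using conv[OF i2] convergent_ignore_initial_segment[of "\<lambda>n. y (2 * n + j)" d]
      unfolding eq by simp
  qed
  show thesis
    using ev[of 0] ev[of 1] that unfolding convergent_def by auto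
qed

lemma tendsto_if_even_odd_subseqs:
  fixes x :: "nat \<Rightarrow> 'a :: topological_space"
  assumes "(\<lambda>n. x (2 * n)) \<longlonglongrightarrow> l" "(\<lambda>n. x (2 * n + 1)) \<longlonglongrightarrow> l"
  shows "x \<longlonglongrightarrow> l"
proof (rule topological_tendstoI)
  fix S assume "open S" "l \<in> S"
  then have "\<forall>\<^sub>F n in sequentially. x (2 * n) \<in> S \<and> x (2 * n + 1) \<in> S"
    using assms by (intro eventually_conj topological_tendstoD)
  then obtain k where k: "\<And>n. k \<le> n \<Longrightarrow> x (2 * n) \<in> S \<and> x (2 * n + 1) \<in> S"
    unfolding eventually_sequentially by blast
  have "x n \<in> S" if "2 * k \<le> n" for n
    using k[of "n div 2"] that by (cases "even n") (auto elim!: evenE oddE)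
  then show "\<forall>\<^sub>F n in sequentially. x n \<in> S"
    unfolding eventually_sequentially by blast
qed

lemma dissipation_tendsto_zero:
  fixes V d :: "nat \<Rightarrow> real"
  assumes "\<And>n. 0 \<le> d n" "\<And>n. V (Suc n) + d n \<le> V n" "\<And>n. - K \<le> V n"
  shows "d \<longlonglongrightarrow> 0"
proof -
  have "decseq V"
    using assms(1,2) by (intro decseq_SucI) (smt (verit))
  then obtain l where "V \<longlonglongrightarrow> l"
    using decseq_convergent[of V "- K"] assms(3) by blast
  then have "(\<lambda>n. V n - V (Suc n)) \<longlonglongrightarrow> l - l"
    by (intro tendsto_diff LIMSEQ_Suc)
  then show ?thesis
    by (intro tendsto_sandwich[of "\<lambda>_. 0" d sequentially "\<lambda>n. V n - V (Suc n)"])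
      (use assms in \<open>auto intro!: always_eventually simp: algebra_simps\<close>)
qed

section \<open>The recursion and its equilibrium\<close>

text \<open>
  The last three inequalities make $[L,\infty)$ invariant: $r + pu + v - L(qu + v)$ equals $\varphi(L)$ plus nonnegative
  multiples of $u - L$ and $v - L$.
\<close>

locale rational_recursion =
  fixes p q r L :: real
  assumes p_pos: "0 < p" and q_pos: "0 < q" and L_pos: "0 < L" and L_less_1: "L < 1"
    and L_less_ratio: "q * L < p" and L_subequilibrium: "(q + 1) * L\<^sup>2 < r + (p + 1) * L"
begin

abbreviation "e \<equiv> ybar p q r"

abbreviation \<phi> :: "real \<Rightarrow> real" where
  "\<phi> x \<equiv> r + (p + 1) * x - (q + 1) * x\<^sup>2"

text \<open>
  The second root of $\varphi$, which may be positive (when $r < 0$) but always lies below $L$.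
\<close>

definition "e' = (p + 1) / (q + 1) - e"

lemma discriminant_pos: "0 < (p + 1)\<^sup>2 + 4 * r * (q + 1)"
proof -
  have "0 < 4 * (q + 1) * (r + (p + 1) * L - (q + 1) * L\<^sup>2)"
    using L_subequilibrium q_pos by simp
  also have "\<dots> \<le> (p + 1)\<^sup>2 + 4 * r * (q + 1)"
    using zero_le_power2[of "2 * (q + 1) * L - (p + 1)"]
    by (simp add: power2_eq_square algebra_simps)
  finally show ?thesis .
qed

lemma phi_factor: "\<phi> x = (q + 1) * (e - x) * (x - e')"
proof -
  define D where "D = (p + 1)\<^sup>2 + 4 * r * (q + 1)"
  have "(sqrt D)\<^sup>2 = D"
    using discriminant_pos by (simp add: D_def)
  moreover have e: "2 * (q + 1) * e = p + 1 + sqrt D"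
    using q_pos by (simp add: ybar_def D_def)
  ultimately have "(2 * (q + 1) * e - (p + 1))\<^sup>2 = D" by simp
  then have "4 * (q + 1) * ((q + 1) * e\<^sup>2 - (p + 1) * e - r) = 0"
    by (simp add: D_def power2_eq_square algebra_simps)
  then have "r = (q + 1) * e\<^sup>2 - (p + 1) * e" using q_pos by simp
  moreover have "(q + 1) * e' = p + 1 - (q + 1) * e"
    using q_pos by (simp add: e'_def field_simps)
  ultimately show ?thesis by algebra
qed

lemma e_bounds: "e' < L" "L < e"
proof -
  have "e' \<le> e"
  proof -
    have "(p + 1) / (2 * (q + 1)) \<le> e"
      unfolding ybar_def using q_pos discriminant_pos by (intro divide_right_mono) auto
    then show ?thesis using q_pos by (simp add: e'_def field_simps)
  qed
  have "0 < (q + 1) * ((e - L) * (L - e'))"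
    using L_subequilibrium phi_factor[of L] by (simp add: mult.assoc)
  then have "0 < (e - L) * (L - e')"
    using q_pos by (simp add: zero_less_mult_iff)
  with \<open>e' \<le> e\<close> show "e' < L" "L < e" by (auto simp: zero_less_mult_iff)
qed

lemma phi_pos_iff: "L \<le> x \<Longrightarrow> 0 < \<phi> x \<longleftrightarrow> x < e"
  and phi_nonneg_iff: "L \<le> x \<Longrightarrow> 0 \<le> \<phi> x \<longleftrightarrow> x \<le> e"
  using e_bounds q_pos unfolding phi_factor
  by (auto simp: zero_less_mult_iff zero_le_mult_iff)

lemma phi_e: "r = (q + 1) * e\<^sup>2 - (p + 1) * e"
  using phi_factor[of e] by simp

lemma fixed_point_iff: "L \<le> x \<Longrightarrow> x * (q * x + x) = r + p * x + x \<longleftrightarrow> x = e"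
  using phi_pos_iff[of x] phi_nonneg_iff[of x] by (auto simp: power2_eq_square algebra_simps)

lemma equilibrium_iff: "is_equilibrium p q r L x \<longleftrightarrow> x = e"
proof -
  have "x = (r + p * x + x) / (q * x + x) \<longleftrightarrow> x * (q * x + x) = r + p * x + x" if "L \<le> x"
    using that q_pos L_pos by (intro eq_divide_eq[THEN trans]) (simp add: add_pos_pos less_imp_neq[symmetric])
  then have "is_equilibrium p q r L x \<longleftrightarrow> L \<le> x \<and> x * (q * x + x) = r + p * x + x"
    unfolding is_equilibrium_def is_solution_def by auto
  then show ?thesis using fixed_point_iff e_bounds by auto
qed


text \<open>
  With $V(u,v) = N(u,v)/(s(u)s(v))$ the left-hand side is
  $V(u,v) - V(w,u)$ times $s(u)s(v)s(w)$. Replacing $w$ by the conjugate $v'$ of $v$ would make it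
  zero. It is quadratic in $w$ with the factor $w - v$, and the recursion turns the second factor
  into a multiple of $w - v$ too, so that the result has a sign wherever the last factor has one.
\<close>

lemma lyapunov_identity:
  fixes u v w :: real
  defines "N \<equiv> \<lambda>x y. (2 - q) * (q * x\<^sup>2 + q * y\<^sup>2 + 2 * x * y) + 2 * (p * q - 1) * (x + y)
      + (r * q * (2 - q) - p * q + 1)"
    and "s \<equiv> \<lambda>x. 2 * p * x - q * x\<^sup>2 - p - q * r"
  assumes "w * (q * u + v) = r + p * u + v"
  shows "N u v * s w - N w u * s v = q * (w - v)\<^sup>2 * (q * u + 1) * (2 * p - 1 + (2 - q) * u)"
  unfolding N_def s_def using assms(3) by algebra

end

section \<open>Solutions and their extreme limit points\<close>

locale recursion_solution = rational_recursion +
  fixes y :: "nat \<Rightarrow> real"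
  assumes solution: "is_solution p q r L y"
begin

lemma step_denominator:
  assumes "L \<le> u" "L \<le> v"
  shows "(q + 1) * L \<le> q * u + v" "0 < q * u + v"
proof -
  show "(q + 1) * L \<le> q * u + v"
    using assms(2) mult_left_mono[OF assms(1), of q] q_pos unfolding distrib_right by linarith
  moreover have "0 < (q + 1) * L" using q_pos L_pos by simp
  ultimately show "0 < q * u + v" by linarith
qed

lemma step: "y (Suc (Suc n)) = (r + p * y (Suc n) + y n) / (q * y (Suc n) + y n)"
  using solution by (simp add: is_solution_def)

lemma ge_L: "L \<le> y n"
proof (induction n rule: induct_nat_012)
  case (ge2 n)
  let ?u = "y (Suc n)" and ?v = "y n"
  have "0 \<le> (p - q * L) * (?u - L) + (1 - L) * (?v - L)"
    using ge2 L_less_ratio L_less_1 by simp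
  then have "L * (q * ?u + ?v) \<le> r + p * ?u + ?v"
    using L_subequilibrium by (simp add: power2_eq_square algebra_simps)
  then show ?case
    unfolding step using step_denominator[OF ge2(2,1)] by (simp add: pos_le_divide_eq)
qed (use solution in \<open>simp_all add: is_solution_def\<close>)

lemma step_mult: "y (Suc (Suc n)) * (q * y (Suc n) + y n) = r + p * y (Suc n) + y n"
  using step_denominator[OF ge_L ge_L, of "Suc n" n] by (simp add: step)

lemma bounded_solution: "\<exists>K. \<forall>n. \<bar>y n\<bar> \<le> K"
proof -
  define K where "K = \<bar>r\<bar> / ((q + 1) * L) + p / q + 1"
  have K: "y (Suc (Suc n)) \<le> K" for n
  proof -
    let ?u = "y (Suc n)" and ?v = "y n"
    note d = step_denominator[OF ge_L ge_L, of "Suc n" n]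
    have qL: "0 < (q + 1) * L" using q_pos L_pos by simp
    have "r \<le> \<bar>r\<bar> / ((q + 1) * L) * ((q + 1) * L)" using q_pos L_pos by simp
    also have "\<dots> \<le> \<bar>r\<bar> / ((q + 1) * L) * (q * ?u + ?v)"
      using d qL by (intro mult_left_mono) auto
    finally have "r \<le> \<bar>r\<bar> / ((q + 1) * L) * (q * ?u + ?v)" .
    moreover have "p * ?u \<le> p / q * (q * ?u + ?v)"
      using p_pos q_pos L_pos ge_L[of n] by (simp add: field_simps)
    moreover have "?v \<le> 1 * (q * ?u + ?v)"
      using q_pos L_pos ge_L[of "Suc n"] by simp
    ultimately have "r + p * ?u + ?v \<le> K * (q * ?u + ?v)"
      unfolding K_def by (simp add: algebra_simps)
    then show ?thesis unfolding step using d by (simp add: pos_divide_le_eq)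
  qed
  have "\<bar>y n\<bar> \<le> max K (max (y 0) (y 1))" for n
  proof -
    have "y n \<le> max K (max (y 0) (y 1))"
      by (induction n rule: induct_nat_012) (use K in \<open>auto simp: le_max_iff_disj\<close>)
    then show ?thesis using ge_L[of n] L_pos by simp
  qed
  then show ?thesis by blast
qed

end

locale ranged_solution = recursion_solution +
  fixes m M :: real
  assumes range: "asymptotic_range y m M"
begin

lemma limit_point_is_image:
  assumes "strict_mono \<rho>" "(\<lambda>n. y (\<rho> n)) \<longlonglongrightarrow> c"
  obtains \<sigma> u v where "c * (q * u + v) = r + p * u + v" "m \<le> u" "u \<le> M" "m \<le> v" "v \<le> M"
    "filterlim \<sigma> at_top sequentially"
    "(\<lambda>n. y (\<sigma> n)) \<longlonglongrightarrow> v" "(\<lambda>n. y (Suc (Suc (\<sigma> n)))) \<longlonglongrightarrow> c"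
proof -
  obtain K where K: "\<And>n. \<bar>y n\<bar> \<le> K" using bounded_solution by blast
  obtain \<sigma> u v where \<sigma>: "filterlim \<sigma> at_top sequentially"
    and v: "(\<lambda>n. y (\<sigma> n)) \<longlonglongrightarrow> v" and u: "(\<lambda>n. y (Suc (\<sigma> n))) \<longlonglongrightarrow> u"
    and c: "(\<lambda>n. y (Suc (Suc (\<sigma> n)))) \<longlonglongrightarrow> c"
    using limit_point_predecessors[OF K assms] by blast
  have \<sigma>': "filterlim (\<lambda>n. Suc (\<sigma> n)) at_top sequentially"
    using filterlim_compose[OF filterlim_Suc \<sigma>] .
  have "(\<lambda>n. y (Suc (Suc (\<sigma> n))) * (q * y (Suc (\<sigma> n)) + y (\<sigma> n))) \<longlonglongrightarrow> c * (q * u + v)"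
    by (intro tendsto_intros u v c)
  moreover have "(\<lambda>n. r + p * y (Suc (\<sigma> n)) + y (\<sigma> n)) \<longlonglongrightarrow> r + p * u + v"
    by (intro tendsto_intros u v)
  ultimately have "c * (q * u + v) = r + p * u + v"
    unfolding step_mult by (rule LIMSEQ_unique)
  then show thesis
    using that \<sigma> v c asymptotic_range_bounds_limits[OF range \<sigma> v]
      asymptotic_range_bounds_limits[OF range \<sigma>' u] by blast
qed

lemma lower_extreme:
  obtains \<sigma> u v where "m * (q * u + v) = r + p * u + v" "m \<le> u" "u \<le> M" "m \<le> v" "v \<le> M"
    "filterlim \<sigma> at_top sequentially"
    "(\<lambda>n. y (\<sigma> n)) \<longlonglongrightarrow> v" "(\<lambda>n. y (Suc (Suc (\<sigma> n)))) \<longlonglongrightarrow> m"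
  using range limit_point_is_image unfolding asymptotic_range_def by metis

lemma upper_extreme:
  obtains \<sigma> u v where "M * (q * u + v) = r + p * u + v" "m \<le> u" "u \<le> M" "m \<le> v" "v \<le> M"
    "filterlim \<sigma> at_top sequentially"
    "(\<lambda>n. y (\<sigma> n)) \<longlonglongrightarrow> v" "(\<lambda>n. y (Suc (Suc (\<sigma> n)))) \<longlonglongrightarrow> M"
  using range limit_point_is_image unfolding asymptotic_range_def by metis

lemma m_le_M: "m \<le> M"
  using lower_extreme by (metis order_trans)

lemma L_le_m: "L \<le> m"
proof -
  obtain \<rho> where "(\<lambda>n. y (\<rho> n)) \<longlonglongrightarrow> m"
    using range unfolding asymptotic_range_def by blast
  then show ?thesis
    using LIMSEQ_le_const ge_L by blast
qed

lemma m_pos: "0 < m"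
  using L_le_m L_pos by linarith

lemma concentrated_converges:
  assumes "m = e" "M = e"
  shows "y \<longlonglongrightarrow> e"
  using range assms unfolding asymptotic_range_def by (intro order_tendstoI) auto

text \<open>
  Bounding $u$ and $v$ in $m = f(u,v)$ by $m$ or $M$, according to the signs of $p - qm$ and
  $1 - m$, gives $m \ge f(c)$ for one of the four corners $c$ of the square $[m,M]^2$. Together
  with $M \le f(m,m)$ each corner yields $\varphi(m) \le 0$, or $M \le m$ directly. But
  $\varphi(m) \le 0$ means $f(m,m) \le m$.
\<close>

lemma concentrated_if_M_le_diagonal:
  assumes diag: "(q + 1) * (m * M) \<le> r + (p + 1) * m"
  shows "m = e \<and> M = e"
proof -
  obtain u v where uv: "m * (q * u + v) = r + p * u + v" "m \<le> u" "u \<le> M" "m \<le> v" "v \<le> M"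
    using lower_extreme by metis
  have eq: "r + u * (p - q * m) + v * (1 - m) = 0"
    using uv(1) by (simp add: algebra_simps)
  show ?thesis
  proof (cases "m = M")
    case True
    then have "u = m" "v = m" using uv by auto
    then show ?thesis using uv(1) fixed_point_iff[OF L_le_m] True by simp
  next
    case False
    then have "m < M" using m_le_M by simp
    have sc: "(q + 1) * (r + u * (p - q * m) + v * (1 - m)) = 0"
      using eq by simp
    have "\<phi> m \<le> 0"
    proof (cases "q * m \<le> p"; cases "m \<le> 1")
      assume "q * m \<le> p" "m \<le> 1"
      then have "m * (p - q * m) \<le> u * (p - q * m)" "m * (1 - m) \<le> v * (1 - m)"
        using uv by (auto intro!: mult_right_mono)
      then show ?thesis using eq by (simp add: power2_eq_square algebra_simps)
    next
      assume *: "q * m \<le> p" "\<not> m \<le> 1"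
      then have "m * (p - q * m) \<le> u * (p - q * m)" "M * (1 - m) \<le> v * (1 - m)"
        using uv by (simp_all add: mult_right_mono mult_right_mono_neg)
      then have "r + m * (p - q * m) + M * (1 - m) \<le> 0" using eq by linarith
      then have "(q + 1) * (r + m * (p - q * m) + M * (1 - m)) \<le> 0"
        using q_pos by (simp add: mult_le_0_iff)
      moreover have "(q + 1) * m \<le> (q + 1) * M" using \<open>m < M\<close> q_pos by simp
      ultimately have "q * \<phi> m \<le> 0"
        using diag by (simp add: power2_eq_square algebra_simps)
      then show ?thesis using q_pos by (simp add: mult_le_0_iff)
    next
      assume *: "\<not> q * m \<le> p" "m \<le> 1"
      then have "M * (p - q * m) \<le> u * (p - q * m)" "m * (1 - m) \<le> v * (1 - m)"
        using uv by (simp_all add: mult_right_mono mult_right_mono_neg)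
      then have "r + M * (p - q * m) + m * (1 - m) \<le> 0" using eq by linarith
      then have "(q + 1) * (r + M * (p - q * m) + m * (1 - m)) \<le> 0"
        using q_pos by (simp add: mult_le_0_iff)
      moreover have "(q + 1) * p * m \<le> (q + 1) * p * M" using \<open>m < M\<close> q_pos p_pos by simp
      moreover have "q * ((q + 1) * (m * M)) \<le> q * (r + (p + 1) * m)"
        using diag q_pos by simp
      ultimately show ?thesis
        by (simp add: power2_eq_square algebra_simps)
    next
      assume *: "\<not> q * m \<le> p" "\<not> m \<le> 1"
      then have "M * (p - q * m) \<le> u * (p - q * m)" "M * (1 - m) \<le> v * (1 - m)"
        using uv by (auto intro!: mult_right_mono_neg)
      then have "(p + 1) * M \<le> (p + 1) * m"
        using eq diag by (simp add: algebra_simps)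
      then show ?thesis using p_pos \<open>m < M\<close> by simp
    qed
    then have "(q + 1) * m * M \<le> (q + 1) * m * m"
      using diag by (simp add: power2_eq_square algebra_simps)
    then have "M \<le> m"
      using q_pos m_pos by simp
    then show ?thesis using \<open>m < M\<close> by simp
  qed
qed

text \<open>
  Above both $1$ and $p/q$ the equation $M = f(u,v)$, written as
  $r + u(p - qM) + v(1 - M) = 0$, has nonpositive coefficients, so the smallest choice $u = v = m$
  gives $M \le f(m,m)$.
\<close>

lemma concentrated_if_M_large:
  assumes "1 \<le> M" "p \<le> q * M"
  shows "m = e \<and> M = e"
proof -
  obtain u v where uv: "M * (q * u + v) = r + p * u + v" "m \<le> u" "m \<le> v"
    using upper_extreme by metis
  have "u * (p - q * M) \<le> m * (p - q * M)" "v * (1 - M) \<le> m * (1 - M)"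
    using uv assms by (auto intro!: mult_right_mono_neg)
  then show ?thesis
    using uv(1) by (intro concentrated_if_M_le_diagonal) (simp add: algebra_simps)
qed

text \<open>
  The mirror image for $m$, where the comparison with the corner $(m,m)$ contradicts
  $\varphi(m) > 0$ at once.
\<close>

lemma m_not_small:
  assumes "m < e" "m \<le> 1" "q * m \<le> p"
  shows False
proof -
  obtain u v where uv: "m * (q * u + v) = r + p * u + v" "m \<le> u" "m \<le> v"
    using lower_extreme by metis
  have "m * (p - q * m) \<le> u * (p - q * m)" "m * (1 - m) \<le> v * (1 - m)"
    using uv assms by (auto intro!: mult_right_mono)
  then show False
    using uv(1) assms(1) phi_pos_iff[OF L_le_m] by (simp add: power2_eq_square algebra_simps)
qed

section \<open>Coefficients of equal sign\<close>

lemma centred_recursion: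
  assumes "c * (q * u + v) = r + p * u + v"
  shows "(c - e) * (q * u + v) = (p - q * e) * (u - e) + (1 - e) * (v - e)"
  using assms phi_e by algebra

text \<open>
  Once $e \le m$, the centred recursion contracts from above: its coefficients add up to
  $p + 1 - (q+1)e$, the denominator is at least $(q+1)e$, and the former is smaller because $e$ is the
  larger root of $\varphi$.
\<close>

lemma concentrated_if_e_small:
  assumes "e \<le> 1" "q * e \<le> p"
  shows "m = e \<and> M = e"
proof -
  have "e \<le> m"
  proof (rule ccontr)
    assume "\<not> e \<le> m"
    moreover then have "q * m \<le> p"
      using assms(2) q_pos by (smt (verit) mult_left_mono)
    ultimately show False using assms m_not_small by simp
  qed
  obtain u v where uv: "M * (q * u + v) = r + p * u + v" "m \<le> u" "u \<le> M" "m \<le> v" "v \<le> M"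
    using upper_extreme by metis
  have "M \<le> e"
  proof (rule ccontr)
    assume "\<not> M \<le> e"
    have "(M - e) * ((q + 1) * e) \<le> (M - e) * (q * u + v)"
    proof (rule mult_left_mono)
      have "q * e \<le> q * u" using uv \<open>e \<le> m\<close> q_pos by simp
      then show "(q + 1) * e \<le> q * u + v" using uv \<open>e \<le> m\<close> by (simp add: algebra_simps)
    qed (use \<open>\<not> M \<le> e\<close> in simp)
    also have "\<dots> = (p - q * e) * (u - e) + (1 - e) * (v - e)"
      using centred_recursion[OF uv(1)] .
    also have "\<dots> \<le> (p - q * e) * (M - e) + (1 - e) * (M - e)"
      using uv assms by (intro add_mono mult_left_mono) auto
    also have "\<dots> = (M - e) * (p + 1 - (q + 1) * e)" by (simp add: algebra_simps)
    finally have "(q + 1) * e \<le> p + 1 - (q + 1) * e"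
      using \<open>\<not> M \<le> e\<close> by simp
    also have "\<dots> = (q + 1) * e'" using q_pos by (simp add: e'_def field_simps)
    finally show False using e_bounds q_pos by simp
  qed
  then show ?thesis using \<open>e \<le> m\<close> m_le_M by simp
qed

lemma concentrated_if_e_large:
  assumes "1 \<le> e" "p \<le> q * e"
  shows "m = e \<and> M = e"
proof (cases "e \<le> M")
  case True
  then have "q * e \<le> q * M" using q_pos by simp
  then show ?thesis using True assms by (intro concentrated_if_M_large) auto
next
  case False
  obtain u v where uv: "m * (q * u + v) = r + p * u + v" "m \<le> u" "u \<le> M" "m \<le> v" "v \<le> M"
    using lower_extreme by metis
  have "0 \<le> (p - q * e) * (u - e)" "0 \<le> (1 - e) * (v - e)"
    using assms False uv by (auto intro!: mult_nonpos_nonpos)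
  then have "0 \<le> (m - e) * (q * u + v)"
    using centred_recursion[OF uv(1)] by simp
  then have "e \<le> m"
    using step_denominator[of u v] uv L_le_m by (simp add: zero_le_mult_iff)
  then show ?thesis using False m_le_M by simp
qed

section \<open>The spiralling case\<close>

text \<open>
  Suppose the solution does not converge to $e$. Then $1 < m$ and $M < p/q$, so the solution
  eventually stays in $[lo,hi]$ with $1 < lo$ and $hi < p/q$. Since $f(u,v) < p/q$ means $qr < (p-q)v$,
  this bounds $s$ below by $(p - qx)(x - 1)$ along the solution. The Lyapunov function is therefore
  bounded, and its total decrease controls $\sum (y_{n+2} - y_n)^2$.
\<close>

lemma concentrated_if_spiral:
  assumes "1 < e" "q * e < p"
  shows "m = e \<and> M = e"
proof (rule ccontr)
  assume not: "\<not> (m = e \<and> M = e)"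
  have M: "M < p / q"
  proof (rule ccontr)
    assume "\<not> M < p / q"
    then have "p \<le> q * M" using q_pos by (simp add: field_simps)
    then have "q * e < q * M" using assms by linarith
    then have "e < M" using q_pos by simp
    then show False using concentrated_if_M_large \<open>p \<le> q * M\<close> not assms by simp
  qed
  have m: "1 < m"
  proof (rule ccontr)
    assume "\<not> 1 < m"
    then have "q * m \<le> q * e" using assms q_pos by simp
    then show False using m_not_small \<open>\<not> 1 < m\<close> assms by simp
  qed
  obtain lo where lo: "1 < lo" "lo < m" using m dense by blast
  obtain hi where hi: "M < hi" "hi < p / q" using M dense by blast
  have "\<forall>\<^sub>F n in sequentially. lo < y n \<and> y n < hi"
    using range lo hi unfolding asymptotic_range_def by (intro eventually_conj) auto
  then obtain n0 where n0: "\<And>n. n0 \<le> n \<Longrightarrow> lo < y n \<and> y n < hi"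
    unfolding eventually_sequentially by blast
  have below: "q * y n < p" if "n0 \<le> n" for n
  proof -
    have "q * y n < q * hi" using n0[OF that] q_pos by simp
    also have "\<dots> < p" using hi q_pos by (simp add: field_simps)
    finally show ?thesis .
  qed
  define s where "s x = 2 * p * x - q * x\<^sup>2 - p - q * r" for x
  define N where "N x z = (2 - q) * (q * x\<^sup>2 + q * z\<^sup>2 + 2 * x * z) + 2 * (p * q - 1) * (x + z)
      + (r * q * (2 - q) - p * q + 1)" for x z
  define \<sigma> where "\<sigma> = (p - q * hi) * (lo - 1)"
  define S where "S = p * p / q - p - q * r"
  have \<sigma>: "0 < \<sigma>"
    unfolding \<sigma>_def using lo hi q_pos by (intro mult_pos_pos) (simp_all add: field_simps)
  have s_low: "\<sigma> \<le> s (y n)" if "n0 \<le> n" for n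
  proof -
    have "y (Suc (Suc n)) < p / q" using n0[of "Suc (Suc n)"] that hi by simp
    then have "q * (r + p * y (Suc n) + y n) < p * (q * y (Suc n) + y n)"
      unfolding step using q_pos step_denominator[OF ge_L ge_L, of "Suc n" n]
      by (simp add: field_simps)
    then have "q * r < (p - q) * y n" by (simp add: algebra_simps)
    then have "(p - q * y n) * (y n - 1) \<le> s (y n)"
      by (simp add: s_def power2_eq_square algebra_simps)
    moreover have "\<sigma> \<le> (p - q * y n) * (y n - 1)"
      unfolding \<sigma>_def using n0[OF that] below[OF that] lo q_pos
      by (intro mult_mono) auto
    ultimately show ?thesis by linarith
  qed
  have s_up: "s x \<le> S" for x
  proof -
    have "0 \<le> (p - q * x)\<^sup>2 / q" using q_pos by simp
    also have "(p - q * x)\<^sup>2 / q = p * p / q - 2 * p * x + q * x\<^sup>2"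
      using q_pos by (simp add: power2_eq_square field_simps)
    finally show ?thesis by (simp add: s_def S_def)
  qed
  have S: "0 < S" using \<sigma> s_low[of n0] s_up[of "y n0"] by linarith
  define V where "V n = N (y (Suc n)) (y n) / (s (y (Suc n)) * s (y n))" for n
  \<comment> \<open>On \<open>[1, p/q]\<close> the factors \<open>q * u + 1\<close> and \<open>2 * p - 1 + (2 - q) * u\<close> are at least \<open>1\<close> and \<open>p + 1\<close>.\<close>
  define \<kappa> where "\<kappa> = q * (p + 1) / (S * S * S)"
  have "0 < \<kappa>" using q_pos p_pos S by (simp add: \<kappa>_def)
  have dissipation: "V (Suc n) + \<kappa> * (y (Suc (Suc n)) - y n)\<^sup>2 \<le> V n" if n: "n0 \<le> n" for n
  proof -
    let ?w = "y (Suc (Suc n))" and ?u = "y (Suc n)" and ?v = "y n"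
    have su: "0 < s ?u" and sv: "0 < s ?v" and sw: "0 < s ?w"
      using s_low[of n] s_low[of "Suc n"] s_low[of "Suc (Suc n)"] \<sigma> n by simp_all
    have "1 < ?u" "q * ?u < p"
      using n0[of "Suc n"] below[of "Suc n"] n lo by auto
    then have t: "p + 1 \<le> 2 * p - 1 + (2 - q) * ?u" by (simp add: algebra_simps)
    have "V n - V (Suc n) = (N ?u ?v * s ?w - N ?w ?u * s ?v) / (s ?u * s ?v * s ?w)"
      using su sv sw by (simp add: V_def field_simps)
    also have "N ?u ?v * s ?w - N ?w ?u * s ?v
        = q * (?w - ?v)\<^sup>2 * (q * ?u + 1) * (2 * p - 1 + (2 - q) * ?u)"
      unfolding N_def s_def by (rule lyapunov_identity[OF step_mult])
    finally have eq: "V n - V (Suc n)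
        = q * (?w - ?v)\<^sup>2 * (q * ?u + 1) * (2 * p - 1 + (2 - q) * ?u) / (s ?u * s ?v * s ?w)" .
    have "q * (?w - ?v)\<^sup>2 * 1 * (p + 1)
        \<le> q * (?w - ?v)\<^sup>2 * (q * ?u + 1) * (2 * p - 1 + (2 - q) * ?u)"
      using q_pos p_pos \<open>1 < ?u\<close> t by (intro mult_mono) auto
    moreover have "0 \<le> q * (?w - ?v)\<^sup>2 * (q * ?u + 1) * (2 * p - 1 + (2 - q) * ?u)"
      using q_pos p_pos \<open>1 < ?u\<close> t by (intro mult_nonneg_nonneg) auto
    moreover have "s ?u * s ?v * s ?w \<le> S * S * S"
      using s_up su sv sw S by (intro mult_mono) auto
    ultimately have "q * (?w - ?v)\<^sup>2 * 1 * (p + 1) / (S * S * S) \<le> V n - V (Suc n)"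
      unfolding eq using su sv sw q_pos p_pos by (intro frac_le) auto
    then show ?thesis by (simp add: \<kappa>_def field_simps)
  qed
  have "\<exists>K. \<forall>n\<ge>n0. - K \<le> V n"
  proof -
    have "compact ((\<lambda>(a, b). N a b) ` ({lo..hi} \<times> {lo..hi}))"
      unfolding N_def case_prod_beta
      by (intro compact_continuous_image compact_Times continuous_intros) auto
    then have "bounded ((\<lambda>(a, b). N a b) ` ({lo..hi} \<times> {lo..hi}))"
      by (rule compact_imp_bounded)
    then obtain B where B: "\<forall>x \<in> (\<lambda>(a, b). N a b) ` ({lo..hi} \<times> {lo..hi}). norm x \<le> B"
      unfolding bounded_iff by blast
    have "- (B / (\<sigma> * \<sigma>)) \<le> V n" if n: "n0 \<le> n" for n
    proof -
      have "\<bar>N (y (Suc n)) (y n)\<bar> \<le> B"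
        using B n0[OF n] n0[of "Suc n"] n by force
      moreover have "\<sigma> * \<sigma> \<le> s (y (Suc n)) * s (y n)"
        using s_low[of n] s_low[of "Suc n"] n \<sigma> by (intro mult_mono) auto
      ultimately have "\<bar>N (y (Suc n)) (y n)\<bar> / \<bar>s (y (Suc n)) * s (y n)\<bar> \<le> B / (\<sigma> * \<sigma>)"
        using \<sigma> by (intro frac_le) auto
      then show ?thesis unfolding V_def abs_divide[symmetric] by linarith
    qed
    then show ?thesis by blast
  qed
  then obtain K where K: "\<And>n. n0 \<le> n \<Longrightarrow> - K \<le> V n" by blast
  have "(\<lambda>n. \<kappa> * (y (Suc (Suc (n + n0))) - y (n + n0))\<^sup>2) \<longlonglongrightarrow> 0"
    by (rule dissipation_tendsto_zero[where V = "\<lambda>n. V (n + n0)" and K = K])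
      (use \<open>0 < \<kappa>\<close> dissipation K in auto)
  then have "(\<lambda>n. \<kappa> * (y (Suc (Suc n)) - y n)\<^sup>2) \<longlonglongrightarrow> 0"
    using LIMSEQ_offset[of "\<lambda>n. \<kappa> * (y (Suc (Suc n)) - y n)\<^sup>2" n0] by simp
  then have "(\<lambda>n. (y (Suc (Suc n)) - y n)\<^sup>2) \<longlonglongrightarrow> 0"
    using tendsto_mult_left_iff[of \<kappa> _ 0] \<open>0 < \<kappa>\<close> by simp
  from tendsto_real_sqrt[OF this] have asympt2: "(\<lambda>n. y (Suc (Suc n)) - y n) \<longlonglongrightarrow> 0"
    by (simp add: tendsto_rabs_zero_iff)
  \<comment> \<open>Terms two steps apart have the same limit points, so the extremes satisfy \<open>c = f u c\<close>.\<close>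
  have predecessor: "v = c"
    if "filterlim \<sigma> at_top sequentially" "(\<lambda>n. y (\<sigma> n)) \<longlonglongrightarrow> v"
      "(\<lambda>n. y (Suc (Suc (\<sigma> n)))) \<longlonglongrightarrow> c" for \<sigma> v c
    using LIMSEQ_unique[OF tendsto_diff[OF that(3,2)] filterlim_compose[OF asympt2 that(1)]] by simp
  have "m < p / q" using m_le_M M by simp
  obtain u where u: "M * (q * u + M) = r + p * u + M" "u \<le> M"
    using upper_extreme predecessor by metis
  have "u * (p - q * M) \<le> M * (p - q * M)"
    using u M q_pos by (intro mult_right_mono) (auto simp: field_simps)
  then have "0 \<le> \<phi> M" using u by (simp add: power2_eq_square algebra_simps)
  then have "M \<le> e" using phi_nonneg_iff L_le_m m_le_M by simp
  obtain u where u: "m * (q * u + m) = r + p * u + m" "m \<le> u"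
    using lower_extreme predecessor by metis
  have "m * (p - q * m) \<le> u * (p - q * m)"
    using u \<open>m < p / q\<close> q_pos by (intro mult_right_mono) (auto simp: field_simps)
  then have "\<phi> m \<le> 0" using u by (simp add: power2_eq_square algebra_simps)
  then have "e \<le> m" using phi_pos_iff[OF L_le_m] by simp
  with \<open>M \<le> e\<close> not m_le_M show False by simp
qed

section \<open>The oscillating case\<close>

text \<open>
  If the solution does not converge to $e$, then $p/q < m$ and $M < 1$. That later terms stay in
  $(p/q,1)$ is itself a statement about their predecessors: $f(u,v) > p/q$ means
  $qr + (q-p)v > 0$, and $f(u,v) < 1$ means $r < (q-p)u$. These are exactly the conditions under
  which $f$ decreases in its first and increases in its second argument.
\<close>

lemma converges_if_oscillatory:
  assumes "e < 1" "p < q * e"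
  shows "y \<longlonglongrightarrow> e \<or> (\<exists>u. is_prime_period_two p q r L u \<and> (\<lambda>n. y n - u n) \<longlonglongrightarrow> 0)"
proof (cases "m = e \<and> M = e")
  case True
  then show ?thesis using concentrated_converges by blast
next
  case not: False
  have M: "M < 1"
  proof (rule ccontr)
    assume "\<not> M < 1"
    then have "q * e \<le> q * M" using assms q_pos by simp
    then show False using concentrated_if_M_large \<open>\<not> M < 1\<close> assms not by simp
  qed
  have m: "p / q < m"
  proof (rule ccontr)
    assume "\<not> p / q < m"
    then have "q * m \<le> p" using q_pos by (simp add: field_simps)
    then have "q * m < q * e" using assms by linarith
    then have "m < e" using q_pos by simp
    then show False using m_not_small \<open>q * m \<le> p\<close> assms by simp
  qed
  have "\<forall>\<^sub>F n in sequentially. p / q < y n \<and> y n < 1"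
    using range m M unfolding asymptotic_range_def by (intro eventually_conj) auto
  then obtain n0 where n0: "\<And>n. n0 \<le> n \<Longrightarrow> p / q < y n \<and> y n < 1"
    unfolding eventually_sequentially by blast
  have monotone_region: "0 < q * r + (q - p) * y n \<and> r < (q - p) * y n" if n: "n0 < n" for n
  proof
    note d = step_denominator(2)[OF ge_L ge_L]
    have "p / q < y (Suc (Suc n))" using n0[of "Suc (Suc n)"] n by simp
    then have "p * (q * y (Suc n) + y n) < q * (r + p * y (Suc n) + y n)"
      unfolding step using q_pos d[of "Suc n" n] by (simp add: field_simps)
    then show "0 < q * r + (q - p) * y n" by (simp add: algebra_simps)
    have "y (Suc (Suc (n - 1))) < 1" using n0[of "Suc (Suc (n - 1))"] n by simp
    then have "r + p * y (Suc (n - 1)) + y (n - 1) < q * y (Suc (n - 1)) + y (n - 1)"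
      unfolding step using d[of "Suc (n - 1)" "n - 1"] by (simp add: field_simps)
    then show "r < (q - p) * y n" using n by (simp add: algebra_simps)
  qed
  obtain K where K: "\<And>n. \<bar>y n\<bar> \<le> K" using bounded_solution by blast
  define f where "f u v = (r + p * u + v) / (q * u + v)" for u v
  have mono: "f u v \<le> f u' v'"
    if "L \<le> u'" "L \<le> v" "u' \<le> u" "v \<le> v'" "0 < q * r + (q - p) * v" "r < (q - p) * u'"
    for u v u' v'
  proof -
    have d: "0 < q * u + v" "0 < q * u' + v" "0 < q * u' + v'"
      using that by (auto intro!: step_denominator)
    have "0 \<le> (u - u') * (q * r + (q - p) * v)" using that by simp
    then have "f u v \<le> f u' v"
      unfolding f_def using d 
      by (intro frac_le_eq[THEN iffD2, OF _ _ divide_nonpos_pos] mult_pos_pos)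
        (simp_all add: algebra_simps)
    also have "0 \<le> (v' - v) * ((q - p) * u' - r)" using that by simp
    then have "f u' v \<le> f u' v'"
      unfolding f_def using d
      by (intro frac_le_eq[THEN iffD2, OF _ _ divide_nonpos_pos] mult_pos_pos)
        (simp_all add: algebra_simps)
    finally show ?thesis .
  qed
  \<comment> \<open>The tail starts at an even index, so that parities are preserved.\<close>
  obtain a b where ab: "(\<lambda>n. y (2 * n + 2 * Suc n0)) \<longlonglongrightarrow> a" "(\<lambda>n. y (2 * n + 1 + 2 * Suc n0)) \<longlonglongrightarrow> b"
  proof (rule antitone_isotone_recursion_converges[of "\<lambda>n. y (n + 2 * Suc n0)" f K])
    show "y (n + 2 + 2 * Suc n0) = f (y (n + 1 + 2 * Suc n0)) (y (n + 2 * Suc n0))" for n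
      using step[of "n + 2 * Suc n0"] by (simp add: f_def)
  qed (use K mono ge_L monotone_region in auto)
  have a: "(\<lambda>n. y (2 * n)) \<longlonglongrightarrow> a"
    by (rule LIMSEQ_offset[where k = "Suc n0"]) (use ab(1) in \<open>simp add: algebra_simps\<close>)
  have b: "(\<lambda>n. y (2 * n + 1)) \<longlonglongrightarrow> b"
    by (rule LIMSEQ_offset[where k = "Suc n0"]) (use ab(2) in \<open>simp add: algebra_simps\<close>)
  have aL: "L \<le> a" and bL: "L \<le> b"
    using LIMSEQ_le_const[OF a] LIMSEQ_le_const[OF b] ge_L by blast+
  have a': "(\<lambda>n. y (Suc (Suc (2 * n)))) \<longlonglongrightarrow> a"
    using LIMSEQ_Suc[OF a] by simp
  have b': "(\<lambda>n. y (Suc (Suc (2 * n + 1)))) \<longlonglongrightarrow> b"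
    using LIMSEQ_Suc[OF b] by simp
  have "a * (q * b + a) = r + p * b + a"
  proof (rule LIMSEQ_unique)
    show "(\<lambda>n. y (Suc (Suc (2 * n))) * (q * y (Suc (2 * n)) + y (2 * n))) \<longlonglongrightarrow> a * (q * b + a)"
      using a a' b by (intro tendsto_intros) simp_all
    show "(\<lambda>n. y (Suc (Suc (2 * n))) * (q * y (Suc (2 * n)) + y (2 * n))) \<longlonglongrightarrow> r + p * b + a"
      unfolding step_mult using a b by (intro tendsto_intros) simp_all
  qed
  moreover have "b * (q * a + b) = r + p * a + b"
  proof (rule LIMSEQ_unique)
    show "(\<lambda>n. y (Suc (Suc (2 * n + 1))) * (q * y (Suc (2 * n + 1)) + y (2 * n + 1)))
        \<longlonglongrightarrow> b * (q * a + b)"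
      using a' b b' by (intro tendsto_intros) simp_all
    show "(\<lambda>n. y (Suc (Suc (2 * n + 1))) * (q * y (Suc (2 * n + 1)) + y (2 * n + 1)))
        \<longlonglongrightarrow> r + p * a + b"
      unfolding step_mult using a' b by (intro tendsto_intros) simp_all
  qed
  ultimately have period_two: "a = (r + p * b + a) / (q * b + a)" "b = (r + p * a + b) / (q * a + b)"
    using step_denominator(2)[OF aL bL] step_denominator(2)[OF bL aL] by (simp_all add: eq_divide_eq)
  define u where "u n = (if even n then a else b)" for n :: nat
  have "(\<lambda>n. y n - u n) \<longlonglongrightarrow> 0"
  proof (rule tendsto_if_even_odd_subseqs)
    show "(\<lambda>n. y (2 * n) - u (2 * n)) \<longlonglongrightarrow> 0"
      using LIM_zero[OF a] by (simp add: u_def)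
    show "(\<lambda>n. y (2 * n + 1) - u (2 * n + 1)) \<longlonglongrightarrow> 0"
      using LIM_zero[OF b] by (simp add: u_def)
  qed
  moreover have "is_solution p q r L u"
    unfolding is_solution_def u_def using period_two aL bL by auto
  ultimately show ?thesis
  proof (cases "a = b")
    case True
    then have "is_equilibrium p q r L a"
      using period_two aL by (simp add: is_equilibrium_def is_solution_def)
    then have "a = e" using equilibrium_iff by simp
    then have "u = (\<lambda>_. e)" using True by (auto simp: u_def)
    then have "y \<longlonglongrightarrow> e"
      using \<open>(\<lambda>n. y n - u n) \<longlonglongrightarrow> 0\<close> by (simp add: LIM_zero_iff)
    then show ?thesis ..
  next
    case False
    then have "is_prime_period_two p q r L u"
      using \<open>is_solution p q r L u\<close> by (simp add: is_prime_period_two_def u_def)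
    then show ?thesis using \<open>(\<lambda>n. y n - u n) \<longlonglongrightarrow> 0\<close> by blast
  qed
qed

end

section \<open>The dichotomy\<close>

context recursion_solution
begin

lemma convergence_dichotomy:
  "y \<longlonglongrightarrow> e \<or> (\<exists>u. is_prime_period_two p q r L u \<and> (\<lambda>n. y n - u n) \<longlonglongrightarrow> 0)"
proof -
  obtain m M where "asymptotic_range y m M"
    using bounded_solution bounded_has_asymptotic_range by metis
  then interpret ranged_solution p q r L y m M by unfold_locales
  consider "e \<le> 1" "q * e \<le> p" | "1 \<le> e" "p \<le> q * e" | "1 < e" "q * e < p" | "e < 1" "p < q * e"
    by linarith
  then show ?thesis
    using concentrated_if_e_small concentrated_if_e_large concentrated_if_spiral
      concentrated_converges converges_if_oscillatory by cases metis+
qed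

end

theorem theorem3:
  fixes \<alpha> \<beta> \<gamma> A B C p q r L :: real
  assumes "\<alpha> > 0" "\<beta> > 0" "\<gamma> > 0" "A > 0" "B > 0" "C > 0"
    and "p = (A * B + (B + C) * \<beta>) / (A * C + (B + C) * \<gamma>)"
    and "q = B / C"
    and "r = C * (B + C) * (B * \<alpha> + C * \<alpha> - A * \<beta> - A * \<gamma>) / (\<gamma> * (B + C) + A * C)\<^sup>2"
    and "L = A * C / (A * C + (B + C) * \<gamma>)"
  shows "(\<forall>e. is_equilibrium p q r L e \<longleftrightarrow> e = ybar p q r) \<and>
    (\<forall>y. is_solution p q r L y \<longrightarrow>
       y \<longlonglongrightarrow> ybar p q r \<or>
       (\<exists>u. is_prime_period_two p q r L u \<and> (\<lambda>n. y n - u n) \<longlonglongrightarrow> 0))"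
proof -
  define D where "D = A * C + (B + C) * \<gamma>"
  have D: "0 < D" using assms by (simp add: D_def add_pos_pos)
  have pD: "p * D = A * B + (B + C) * \<beta>" and LD: "L * D = A * C" and qC: "q * C = B"
    using assms D by (simp_all add: D_def)
  have rD: "r * D\<^sup>2 = C * (B + C) * (B * \<alpha> + C * \<alpha> - A * \<beta> - A * \<gamma>)"
  proof -
    have "\<gamma> * (B + C) + A * C = D" by (simp add: D_def algebra_simps)
    then show ?thesis using assms(9) D by simp
  qed
  interpret rational_recursion p q r L
  proof
    show "0 < p" "0 < q" "0 < L" using assms by (simp_all add: add_pos_pos)
    show "L < 1" using assms by (simp add: add_pos_pos)
    show "q * L < p"
    proof -
      have "q * L * D = A * (q * C)" using LD by algebra
      also have "\<dots> < p * D" unfolding qC pD using assms by simp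
      finally have "q * L * D < p * D" .
      then show ?thesis using D by simp
    qed
    show "(q + 1) * L\<^sup>2 < r + (p + 1) * L"
    proof -
      \<comment> \<open>Multiplying by \<open>C\<close> clears the denominator of \<open>q\<close>.\<close>
      have "C * ((r + (p + 1) * L - (q + 1) * L\<^sup>2) * D\<^sup>2) = C * (C * (B + C)\<^sup>2 * \<alpha>)"
        using pD LD qC rD unfolding D_def by algebra
      then have "(r + (p + 1) * L - (q + 1) * L\<^sup>2) * D\<^sup>2 = C * (B + C)\<^sup>2 * \<alpha>"
        using assms by simp
      also have "\<dots> > 0" using assms by (simp add: add_pos_pos)
      finally show ?thesis using D by (simp add: zero_less_mult_iff)
    qed
  qed
  show ?thesis
  proof (intro conjI allI impI)
    fix y assume "is_solution p q r L y"
    then interpret recursion_solution p q r L y by unfold_locales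
    show "y \<longlonglongrightarrow> ybar p q r \<or> (\<exists>u. is_prime_period_two p q r L u \<and> (\<lambda>n. y n - u n) \<longlonglongrightarrow> 0)"
      by (rule convergence_dichotomy)
  qed (rule equilibrium_iff)
qed

end
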